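(* Let $T$ be the binary rooted tree. There exists a contracting self-similar group $\Gamma\subset\mathrm{Aut}(T)$ whose action $(\partial T,\Gamma,\Phi)$ on the boundary $\partial T$ is minimal and such that: for every $x\in\partial T$ and every adapted neighborhood basis at $x$, the inclusion $\Upsilon^{x,\Gamma}_c(\Phi)\to\Upsilon^{x,\Gamma}_s(\Phi)$ of the direct limit countable centralizer group into the direct limit countable stabilizer group is not an isomorphism, while the germinal groupoid $\mathcal G(\partial T,\Gamma,\Phi)$ has Hausdorff topology.
   Context: The binary rooted tree $T$ has as vertices the finite words over $\{0,1\}$ (root = empty word), each word $u$ joined by edges to $u0,u1$. $\partial T$ is the set of infinite words over $\{0,1\}$ with the product topology (a Cantor set); $\mathrm{Aut}(T)$ acts on it by homeomorphisms (equicontinuously). For $g\in\mathrm{Aut}(T)$ and a word $w$, the section $g|_w\in\mathrm{Aut}(T)$ is defined by $g(wk)=g(w)\,g|_w(k)$. A subgroup $\Gamma\subset\mathrm{Aut}(T)$ is self-similar if $g|_w\in\Gamma$ for all $g\in\Gamma$ and all words $w$. A self-similar $\Gamma$ is contracting if there is a finite set $\mathcal N\subset\Gamma$ such that for every $g\in\Gamma$ there is $n_g\ge0$ with $g|_w\in\mathcal N$ for all words $w$ of length at least $n_g$. An action is minimal if every orbit is dense. A nonempty clopen set $U\subset\partial T$ is adapted if for every $g\in\Gamma$ either $g\cdot U=U$ or $g\cdot U\cap U=\emptyset$. An adapted neighborhood basis at $x$ is a properly descending chain $\{U_\ell\mid\ell\ge0\}$ of adapted clopen sets with $U_0=\partial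 T$, $x\in U_\ell$, $\bigcap_\ell U_\ell=\{x\}$. Put $\Gamma_\ell=\{g\in\Gamma\mid g\cdot U_\ell=U_\ell\}$, $\mathcal K=\bigcap_\ell\Gamma_\ell$, $K^\Gamma_\ell=\{h\in\mathcal K\mid[h,g]\in\mathcal K\ \forall g\in\Gamma_\ell\}$, $Z^\Gamma_\ell=\{h\in\mathcal K\mid[h,g]=\mathrm{id}\ \forall g\in\Gamma_\ell\}$. Then $Z^\Gamma_\ell\subset K^\Gamma_\ell$ are increasing in $\ell$; $\Upsilon^{x,\Gamma}_s(\Phi)$ and $\Upsilon^{x,\Gamma}_c(\Phi)$ are the direct limits (along inclusions) of $\{K^\Gamma_\ell\}$ and $\{Z^\Gamma_\ell\}$ respectively. Germinal groupoid: for $g\in\Gamma$, $y\in\partial T$, the germ $[g]_y$ is the class of $g$ under $g_1\sim_y g_2$ iff $g_1\cdot y=g_2\cdot y$ and $g_1,g_2$ agree on an open neighborhood of $y$. $\mathcal G(\partial T,\Gamma,\Phi)=\{[g]_y\}$ with the sheaf topology, with basis the sets $\{[g]_y\mid y\in U\}$, $g\in\Gamma$, $U$ open. *)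

theory Defs
  imports "HOL-Analysis.Analysis" "HOL-Algebra.Group"
begin

section \<open>The binary rooted tree and its automorphism group\<close>

text \<open>The letters 0 and 1 are represented by \<^const>\<open>False\<close> and \<^const>\<open>True\<close>, vertices by
  lists of letters, and the boundary by the type \<^typ>\<open>nat \<Rightarrow> bool\<close>, whose library topology is the
  product of the discrete topologies.\<close>

type_synonym vertex = "bool list"
type_synonym boundary = "nat \<Rightarrow> bool"

definition tree_edge :: "vertex \<Rightarrow> vertex \<Rightarrow> bool" where
  "tree_edge u v \<longleftrightarrow> (\<exists>b. v = u @ [b]) \<or> (\<exists>b. u = v @ [b])"

definition AutT :: "(vertex \<Rightarrow> vertex) monoid" where
  "AutT = \<lparr>carrier = {g. bij g \<and> g [] = [] \<and> (\<forall>u v. tree_edge (g u) (g v) \<longleftrightarrow> tree_edge u v)},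
           mult = (\<lambda>g h. g \<circ> h), one = id\<rparr>"

definition word_prefix :: "boundary \<Rightarrow> nat \<Rightarrow> vertex" where
  "word_prefix x n = map x [0..<n]"

text \<open>The infinite word \<open>g \<cdot> x\<close> is the one whose prefixes are the images under \<open>g\<close> of the prefixes
  of \<open>x\<close>; see \<open>word_prefix_bdry_act\<close>.\<close>

definition bdry_act :: "(vertex \<Rightarrow> vertex) \<Rightarrow> boundary \<Rightarrow> boundary" where
  "bdry_act g x = (\<lambda>n. g (word_prefix x (Suc n)) ! n)"

text \<open>The equation \<open>g (w k) = g (w) g|\<^sub>w (k)\<close> is lemma \<open>section_eq\<close>.\<close>

definition tree_section :: "(vertex \<Rightarrow> vertex) \<Rightarrow> vertex \<Rightarrow> vertex \<Rightarrow> vertex" where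
  "tree_section g w = (\<lambda>k. drop (length (g w)) (g (w @ k)))"

lemma AutT_simps [simp]:
  "mult AutT g h = g \<circ> h" "one AutT = id"
  by (simp_all add: AutT_def)

lemma AutT_carrier:
  "g \<in> carrier AutT \<longleftrightarrow>
     bij g \<and> g [] = [] \<and> (\<forall>u v. tree_edge (g u) (g v) \<longleftrightarrow> tree_edge u v)"
  by (simp add: AutT_def)

lemma AutT_inv_carrier:
  assumes "g \<in> carrier AutT"
  shows "Hilbert_Choice.inv g \<in> carrier AutT"
proof -
  have g: "bij g" "g [] = []" "\<And>u v. tree_edge (g u) (g v) \<longleftrightarrow> tree_edge u v"
    using assms by (auto simp: AutT_carrier)
  have "tree_edge (Hilbert_Choice.inv g u) (Hilbert_Choice.inv g v) \<longleftrightarrow> tree_edge u v" for u v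
    using g(3)[of "Hilbert_Choice.inv g u" "Hilbert_Choice.inv g v"] g(1)
    by (simp add: bij_is_surj surj_f_inv_f)
  moreover have "Hilbert_Choice.inv g [] = []"
    using g(1,2) by (metis bij_inv_eq_iff)
  ultimately show ?thesis
    using g(1) by (simp add: AutT_carrier bij_imp_bij_inv)
qed

lemma group_AutT: "group AutT"
proof (rule groupI)
  fix g h assume "g \<in> carrier AutT" "h \<in> carrier AutT"
  then show "g \<otimes>\<^bsub>AutT\<^esub> h \<in> carrier AutT"
    by (auto simp: AutT_carrier bij_comp)
next
  fix g assume g: "g \<in> carrier AutT"
  then have "Hilbert_Choice.inv g \<circ> g = id"
    by (simp add: AutT_carrier bij_is_inj)
  then show "\<exists>h\<in>carrier AutT. h \<otimes>\<^bsub>AutT\<^esub> g = \<one>\<^bsub>AutT\<^esub>"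
    using AutT_inv_carrier[OF g] by auto
qed (auto simp: AutT_carrier comp_assoc)

interpretation AutT: group AutT
  by (rule group_AutT)

lemma AutT_snoc:
  assumes "g \<in> carrier AutT"
  shows "\<exists>c. g (w @ [b]) = g w @ [c]"
proof (induction w arbitrary: b rule: rev_induct)
  case Nil
  have "tree_edge [] [b]"
    by (simp add: tree_edge_def)
  then have "tree_edge (g []) (g [b])"
    using assms unfolding AutT_carrier by blast
  then show ?case
    using assms by (auto simp: AutT_carrier tree_edge_def)
next
  case (snoc d w)
  obtain c where c: "g (w @ [d]) = g w @ [c]" using snoc by blast
  have "tree_edge (g (w @ [d])) (g ((w @ [d]) @ [b]))"
    using assms unfolding AutT_carrier tree_edge_def by blast
  moreover have "g ((w @ [d]) @ [b]) \<noteq> g w"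
    using assms by (auto simp: AutT_carrier dest!: bij_is_inj injD)
  ultimately show ?case
    using c by (auto simp: tree_edge_def)
qed

lemma AutT_append:
  assumes "g \<in> carrier AutT"
  shows "\<exists>v. g (w @ k) = g w @ v \<and> length v = length k"
proof (induction k rule: rev_induct)
  case (snoc b k)
  then show ?case
    using AutT_snoc[OF assms, of "w @ k" b] by fastforce
qed auto

lemma AutT_length:
  assumes "g \<in> carrier AutT"
  shows "length (g w) = length w"
  using AutT_append[OF assms, of "[]" w] assms by (auto simp: AutT_carrier)

lemma section_eq:
  assumes "g \<in> carrier AutT"
  shows "g (w @ k) = g w @ tree_section g w k"
  using AutT_append[OF assms, of w k] by (auto simp: tree_section_def)

lemma word_prefix_bdry_act:
  assumes "g \<in> carrier AutT"
  shows "word_prefix (bdry_act g x) n = g (word_prefix x n)"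
proof (rule nth_equalityI)
  show "length (word_prefix (bdry_act g x) n) = length (g (word_prefix x n))"
    by (simp add: word_prefix_def AutT_length[OF assms])
next
  fix i assume "i < length (word_prefix (bdry_act g x) n)"
  then have i: "i < n" by (simp add: word_prefix_def)
  then have "[0..<n] = [0..<Suc i] @ [Suc i..<n]"
    by (metis Suc_leI le0 le_add_diff_inverse upt_add_eq_append)
  then have "word_prefix x n = word_prefix x (Suc i) @ map x [Suc i..<n]"
    by (metis map_append word_prefix_def)
  then have "g (word_prefix x n)
      = g (word_prefix x (Suc i)) @ tree_section g (word_prefix x (Suc i)) (map x [Suc i..<n])"
    by (simp add: section_eq[OF assms])
  moreover have "length (g (word_prefix x (Suc i))) = Suc i"
    by (simp add: AutT_length[OF assms] word_prefix_def)
  ultimately have "g (word_prefix x n) ! i = g (word_prefix x (Suc i)) ! i"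
    by (simp add: nth_append)
  then show "word_prefix (bdry_act g x) n ! i = g (word_prefix x n) ! i"
    using i by (simp add: word_prefix_def bdry_act_def del: upt_Suc)
qed

lemma bdry_act_comp:
  assumes "g \<in> carrier AutT" "h \<in> carrier AutT"
  shows "bdry_act (g \<circ> h) x = bdry_act g (bdry_act h x)"
  by (simp add: bdry_act_def[of "g \<circ> h"] bdry_act_def[of g] word_prefix_bdry_act[OF assms(2)])

lemma bdry_act_id [simp]: "bdry_act id x = x"
  by (simp add: bdry_act_def word_prefix_def fun_eq_iff del: upt_Suc)


section \<open>Self-similar contracting groups and minimality\<close>

definition self_similar :: "(vertex \<Rightarrow> vertex) set \<Rightarrow> bool" where
  "self_similar \<Gamma> \<longleftrightarrow> subgroup \<Gamma> AutT \<and> (\<forall>g\<in>\<Gamma>. \<forall>w. tree_section g w \<in> \<Gamma>)"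

definition contracting :: "(vertex \<Rightarrow> vertex) set \<Rightarrow> bool" where
  "contracting \<Gamma> \<longleftrightarrow>
     (\<exists>N. finite N \<and> N \<subseteq> \<Gamma> \<and> (\<forall>g\<in>\<Gamma>. \<exists>n. \<forall>w. n \<le> length w \<longrightarrow> tree_section g w \<in> N))"

definition minimal_action :: "(vertex \<Rightarrow> vertex) set \<Rightarrow> bool" where
  "minimal_action \<Gamma> \<longleftrightarrow> (\<forall>x. closure ((\<lambda>g. bdry_act g x) ` \<Gamma>) = UNIV)"


section \<open>Adapted sets, stabilizer and centralizer groups\<close>

definition adapted :: "(vertex \<Rightarrow> vertex) set \<Rightarrow> boundary set \<Rightarrow> bool" where
  "adapted \<Gamma> U \<longleftrightarrow> U \<noteq> {} \<and> open U \<and> closed U \<and>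
     (\<forall>g\<in>\<Gamma>. bdry_act g ` U = U \<or> bdry_act g ` U \<inter> U = {})"

definition adapted_nbhd_basis ::
    "(vertex \<Rightarrow> vertex) set \<Rightarrow> boundary \<Rightarrow> (nat \<Rightarrow> boundary set) \<Rightarrow> bool" where
  "adapted_nbhd_basis \<Gamma> x U \<longleftrightarrow>
     U 0 = UNIV \<and> (\<forall>l. adapted \<Gamma> (U l)) \<and> (\<forall>l. U (Suc l) \<subset> U l) \<and>
     (\<forall>l. x \<in> U l) \<and> (\<Inter>l. U l) = {x}"

definition set_stab ::
    "(vertex \<Rightarrow> vertex) set \<Rightarrow> (nat \<Rightarrow> boundary set) \<Rightarrow> nat \<Rightarrow> (vertex \<Rightarrow> vertex) set" where
  "set_stab \<Gamma> U l = {g \<in> \<Gamma>. bdry_act g ` U l = U l}"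

definition kernel_group ::
    "(vertex \<Rightarrow> vertex) set \<Rightarrow> (nat \<Rightarrow> boundary set) \<Rightarrow> (vertex \<Rightarrow> vertex) set" where
  "kernel_group \<Gamma> U = (\<Inter>l. set_stab \<Gamma> U l)"

definition commutator :: "('a, 'm) monoid_scheme \<Rightarrow> 'a \<Rightarrow> 'a \<Rightarrow> 'a" where
  "commutator G h g = h \<otimes>\<^bsub>G\<^esub> g \<otimes>\<^bsub>G\<^esub> inv\<^bsub>G\<^esub> h \<otimes>\<^bsub>G\<^esub> inv\<^bsub>G\<^esub> g"

definition K_group ::
    "(vertex \<Rightarrow> vertex) set \<Rightarrow> (nat \<Rightarrow> boundary set) \<Rightarrow> nat \<Rightarrow> (vertex \<Rightarrow> vertex) set" where
  "K_group \<Gamma> U l =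
     {h \<in> kernel_group \<Gamma> U. \<forall>g\<in>set_stab \<Gamma> U l. commutator AutT h g \<in> kernel_group \<Gamma> U}"

definition Z_group ::
    "(vertex \<Rightarrow> vertex) set \<Rightarrow> (nat \<Rightarrow> boundary set) \<Rightarrow> nat \<Rightarrow> (vertex \<Rightarrow> vertex) set" where
  "Z_group \<Gamma> U l =
     {h \<in> kernel_group \<Gamma> U. \<forall>g\<in>set_stab \<Gamma> U l. commutator AutT h g = \<one>\<^bsub>AutT\<^esub>}"


section \<open>Direct limits of sequences of groups\<close>

text \<open>For groups \<open>G i\<close> and bonding maps \<open>f i j\<close> from \<open>G i\<close> to \<open>G j\<close> (\<open>i \<le> j\<close>), the direct limit is
  the quotient of the disjoint union of the carriers that identifies elements which eventually
  become equal; two classes are multiplied at a common stage.\<close>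

definition dirlim_rel ::
    "(nat \<Rightarrow> ('a, 'm) monoid_scheme) \<Rightarrow> (nat \<Rightarrow> nat \<Rightarrow> 'a \<Rightarrow> 'a) \<Rightarrow> ((nat \<times> 'a) \<times> (nat \<times> 'a)) set" where
  "dirlim_rel G f = {((i, a), (j, b)). a \<in> carrier (G i) \<and> b \<in> carrier (G j) \<and>
     (\<exists>k. i \<le> k \<and> j \<le> k \<and> f i k a = f j k b)}"

definition dirlim ::
    "(nat \<Rightarrow> ('a, 'm) monoid_scheme) \<Rightarrow> (nat \<Rightarrow> nat \<Rightarrow> 'a \<Rightarrow> 'a) \<Rightarrow> (nat \<times> 'a) set monoid" where
  "dirlim G f = \<lparr>
     carrier = (SIGMA i:UNIV. carrier (G i)) // dirlim_rel G f,
     mult = (\<lambda>X Y. \<Union>{dirlim_rel G f `` {(k, f i k a \<otimes>\<^bsub>G k\<^esub> f j k b)} | i a j b k.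
                        (i, a) \<in> X \<and> (j, b) \<in> Y \<and> i \<le> k \<and> j \<le> k}),
     one = dirlim_rel G f `` {(0, \<one>\<^bsub>G 0\<^esub>)}\<rparr>"

text \<open>The map between direct limits induced by maps \<open>\<phi> i\<close> from \<open>G i\<close> to \<open>H i\<close>, where \<open>f'\<close> are
  the bonding maps of \<open>H\<close>.\<close>

definition dirlim_map ::
    "(nat \<Rightarrow> ('b, 'm) monoid_scheme) \<Rightarrow> (nat \<Rightarrow> nat \<Rightarrow> 'b \<Rightarrow> 'b) \<Rightarrow> (nat \<Rightarrow> 'a \<Rightarrow> 'b)
       \<Rightarrow> (nat \<times> 'a) set \<Rightarrow> (nat \<times> 'b) set" where
  "dirlim_map H f' \<phi> X = (\<Union>(i, a)\<in>X. dirlim_rel H f' `` {(i, \<phi> i a)})"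

abbreviation K_system ::
    "(vertex \<Rightarrow> vertex) set \<Rightarrow> (nat \<Rightarrow> boundary set) \<Rightarrow> nat \<Rightarrow> (vertex \<Rightarrow> vertex) monoid" where
  "K_system \<Gamma> U l \<equiv> AutT\<lparr>carrier := K_group \<Gamma> U l\<rparr>"

abbreviation Z_system ::
    "(vertex \<Rightarrow> vertex) set \<Rightarrow> (nat \<Rightarrow> boundary set) \<Rightarrow> nat \<Rightarrow> (vertex \<Rightarrow> vertex) monoid" where
  "Z_system \<Gamma> U l \<equiv> AutT\<lparr>carrier := Z_group \<Gamma> U l\<rparr>"

text \<open>Both the bonding maps and the maps from \<open>Z_group\<close> to \<open>K_group\<close> are inclusions, hence act as
  the identity on elements.\<close>

definition Upsilon_s ::
    "(vertex \<Rightarrow> vertex) set \<Rightarrow> (nat \<Rightarrow> boundary set) \<Rightarrow> (nat \<times> (vertex \<Rightarrow> vertex)) set monoid" where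
  "Upsilon_s \<Gamma> U = dirlim (K_system \<Gamma> U) (\<lambda>i j. id)"

definition Upsilon_c ::
    "(vertex \<Rightarrow> vertex) set \<Rightarrow> (nat \<Rightarrow> boundary set) \<Rightarrow> (nat \<times> (vertex \<Rightarrow> vertex)) set monoid" where
  "Upsilon_c \<Gamma> U = dirlim (Z_system \<Gamma> U) (\<lambda>i j. id)"

definition Upsilon_incl ::
    "(vertex \<Rightarrow> vertex) set \<Rightarrow> (nat \<Rightarrow> boundary set)
       \<Rightarrow> (nat \<times> (vertex \<Rightarrow> vertex)) set \<Rightarrow> (nat \<times> (vertex \<Rightarrow> vertex)) set" where
  "Upsilon_incl \<Gamma> U = dirlim_map (K_system \<Gamma> U) (\<lambda>i j. id) (\<lambda>l. id)"


section \<open>The germinal groupoid\<close>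

definition germ_rel ::
    "(vertex \<Rightarrow> vertex) set \<Rightarrow> boundary \<Rightarrow> ((vertex \<Rightarrow> vertex) \<times> (vertex \<Rightarrow> vertex)) set" where
  "germ_rel \<Gamma> y = {(g1, g2). g1 \<in> \<Gamma> \<and> g2 \<in> \<Gamma> \<and> bdry_act g1 y = bdry_act g2 y \<and>
     (\<exists>V. open V \<and> y \<in> V \<and> (\<forall>z\<in>V. bdry_act g1 z = bdry_act g2 z))}"

text \<open>The base point is recorded in the germ, so that germs at different points are different
  even when the underlying classes of group elements coincide.\<close>

definition germ ::
    "(vertex \<Rightarrow> vertex) set \<Rightarrow> (vertex \<Rightarrow> vertex) \<Rightarrow> boundary \<Rightarrow> boundary \<times> (vertex \<Rightarrow> vertex) set" where
  "germ \<Gamma> g y = (y, germ_rel \<Gamma> y `` {g})"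

definition germ_base ::
    "(vertex \<Rightarrow> vertex) set \<Rightarrow> (boundary \<times> (vertex \<Rightarrow> vertex) set) set set" where
  "germ_base \<Gamma> = {germ \<Gamma> g ` U | g U. g \<in> \<Gamma> \<and> open U}"

text \<open>The sets in \<open>germ_base \<Gamma>\<close> form a basis of this topology, not merely a subbasis
  (lemma \<open>openin_germinal_groupoid\<close>).\<close>

definition germinal_groupoid ::
    "(vertex \<Rightarrow> vertex) set \<Rightarrow> (boundary \<times> (vertex \<Rightarrow> vertex) set) topology" where
  "germinal_groupoid \<Gamma> = topology_generated_by (germ_base \<Gamma>)"


section \<open>Basic facts\<close>

lemma equiv_germ_rel: "equiv \<Gamma> (germ_rel \<Gamma> y)"
proof (rule equivI)
  show "trans (germ_rel \<Gamma> y)"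
  proof (rule transI)
    fix g h k assume "(g, h) \<in> germ_rel \<Gamma> y" "(h, k) \<in> germ_rel \<Gamma> y"
    then obtain V W where "g \<in> \<Gamma>" "k \<in> \<Gamma>" "open V" "y \<in> V" "open W" "y \<in> W"
      "\<forall>z\<in>V. bdry_act g z = bdry_act h z" "\<forall>z\<in>W. bdry_act h z = bdry_act k z"
      by (auto simp: germ_rel_def)
    then show "(g, k) \<in> germ_rel \<Gamma> y"
      unfolding germ_rel_def by (auto intro!: exI[of _ "V \<inter> W"])
  qed
  show "sym (germ_rel \<Gamma> y)"
    unfolding germ_rel_def by (rule symI) (auto; metis)
qed (auto simp: germ_rel_def refl_on_def)

lemma topspace_germinal_groupoid:
  "topspace (germinal_groupoid \<Gamma>) = {germ \<Gamma> g y | g y. g \<in> \<Gamma>}"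
  unfolding germinal_groupoid_def topology_generated_by_topspace germ_base_def
  by (auto; metis open_UNIV UNIV_I image_eqI)

lemma openin_germinal_groupoid:
  "openin (germinal_groupoid \<Gamma>) = arbitrary union_of (\<lambda>S. S \<in> germ_base \<Gamma>)"
proof -
  have Int: "(arbitrary union_of (\<lambda>S. S \<in> germ_base \<Gamma>)) (A \<inter> B)"
    if AB: "A \<in> germ_base \<Gamma>" "B \<in> germ_base \<Gamma>" for A B
  proof -
    obtain g U h V where gh: "g \<in> \<Gamma>" "h \<in> \<Gamma>" "open U" "open V"
      and A: "A = germ \<Gamma> g ` U" and B: "B = germ \<Gamma> h ` V"
      using AB unfolding germ_base_def by blast
    have "\<exists>C\<in>germ_base \<Gamma>. p \<in> C \<and> C \<subseteq> A \<inter> B" if p: "p \<in> A \<inter> B" for p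
    proof -
      obtain y where y: "y \<in> U" "y \<in> V" "p = germ \<Gamma> g y" "germ \<Gamma> g y = germ \<Gamma> h y"
        using p by (auto simp: A B germ_def)
      then have "(g, h) \<in> germ_rel \<Gamma> y"
        using gh by (intro eq_equiv_class[OF _ equiv_germ_rel]) (auto simp: germ_def)
      then obtain W where W: "open W" "y \<in> W" "\<forall>z\<in>W. bdry_act g z = bdry_act h z"
        by (auto simp: germ_rel_def)
      have eq: "germ \<Gamma> g z = germ \<Gamma> h z" if "z \<in> W" for z
      proof -
        have "(g, h) \<in> germ_rel \<Gamma> z"
          using W gh that by (auto simp: germ_rel_def)
        then show ?thesis
          using equiv_class_eq[OF equiv_germ_rel] by (simp add: germ_def)
      qed
      have "germ \<Gamma> g ` (U \<inter> V \<inter> W) \<in> germ_base \<Gamma>"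
        using gh W by (auto simp: germ_base_def)
      moreover have "p \<in> germ \<Gamma> g ` (U \<inter> V \<inter> W)"
        using y(1,2) W(2) unfolding y(3) by blast
      moreover have "germ \<Gamma> g ` (U \<inter> V \<inter> W) \<subseteq> A \<inter> B" 
      proof
        fix q assume "q \<in> germ \<Gamma> g ` (U \<inter> V \<inter> W)"
        then obtain z where "z \<in> U" "z \<in> V" "z \<in> W" "q = germ \<Gamma> g z" by blast
        then show "q \<in> A \<inter> B" unfolding A B using eq[of z] by blast
      qed
      ultimately show ?thesis by (intro bexI conjI)
    qed
    then have ex: "\<exists>C. C \<in> germ_base \<Gamma> \<and> p \<in> C \<and> C \<subseteq> A \<inter> B" if "p \<in> A \<inter> B" for p
      using that by blast
    show ?thesis
      by (subst arbitrary_union_of_alt) (intro ballI ex)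
  qed
  have ist: "istopology (arbitrary union_of (\<lambda>S. S \<in> germ_base \<Gamma>))"
    unfolding istopology_base_eq using Int by blast
  show ?thesis
  proof (rule ext, rule iffI)
    fix S assume "openin (germinal_groupoid \<Gamma>) S"
    then have "generate_topology_on (germ_base \<Gamma>) S"
      by (simp add: germinal_groupoid_def openin_topology_generated_by_iff)
    moreover have "(arbitrary union_of (\<lambda>S. S \<in> germ_base \<Gamma>)) B" if "B \<in> germ_base \<Gamma>" for B
      using that by (rule arbitrary_union_of_inc)
    ultimately show "(arbitrary union_of (\<lambda>S. S \<in> germ_base \<Gamma>)) S"
      using generate_topology_on_coarsest[OF ist] by blast
  next
    fix S assume "(arbitrary union_of (\<lambda>S. S \<in> germ_base \<Gamma>)) S"
    then obtain \<C> where "\<C> \<subseteq> germ_base \<Gamma>" "\<Union>\<C> = S" by (auto simp: union_of_def)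
    then show "openin (germinal_groupoid \<Gamma>) S"
      unfolding germinal_groupoid_def
      by (metis openin_Union subsetD topology_generated_by_Basis)
  qed
qed

lemma subgroup_set_stab:
  assumes "subgroup \<Gamma> AutT"
  shows "subgroup (set_stab \<Gamma> U l) AutT"
proof -
  interpret S: subgroup \<Gamma> AutT by fact
  have sub: "g \<in> carrier AutT" if "g \<in> \<Gamma>" for g using that S.subset by blast
  have comp: "bdry_act (g \<circ> h) ` A = bdry_act g ` bdry_act h ` A" if "g \<in> \<Gamma>" "h \<in> \<Gamma>" for g h A
    using that by (auto simp: bdry_act_comp sub image_iff)
  show ?thesis
  proof (rule AutT.subgroupI)
    show "set_stab \<Gamma> U l \<subseteq> carrier AutT" using sub by (auto simp: set_stab_def)
    have "id \<in> set_stab \<Gamma> U l" using S.one_closed by (auto simp: set_stab_def)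
    then show "set_stab \<Gamma> U l \<noteq> {}" by blast
  next
    fix g assume "g \<in> set_stab \<Gamma> U l"
    then have g: "g \<in> \<Gamma>" "bdry_act g ` U l = U l" by (auto simp: set_stab_def)
    have "inv\<^bsub>AutT\<^esub> g \<circ> g = id" using AutT.l_inv[OF sub[OF g(1)]] by simp
    moreover have "inv\<^bsub>AutT\<^esub> g \<in> \<Gamma>" using g(1) by simp
    ultimately have "bdry_act (inv\<^bsub>AutT\<^esub> g) ` bdry_act g ` U l = U l"
      using comp[of "inv\<^bsub>AutT\<^esub> g" g "U l"] g(1) by simp
    then show "inv\<^bsub>AutT\<^esub> g \<in> set_stab \<Gamma> U l"
      using g \<open>inv\<^bsub>AutT\<^esub> g \<in> \<Gamma>\<close> by (simp add: set_stab_def)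
  next
    fix g h assume "g \<in> set_stab \<Gamma> U l" "h \<in> set_stab \<Gamma> U l"
    then show "g \<otimes>\<^bsub>AutT\<^esub> h \<in> set_stab \<Gamma> U l"
      using S.m_closed[of g h] comp[of g h] by (auto simp: set_stab_def simp del: bdry_act_id)
  qed
qed

lemma subgroup_kernel_group:
  assumes "subgroup \<Gamma> AutT"
  shows "subgroup (kernel_group \<Gamma> U) AutT"
proof -
  have "subgroup (\<Inter>(range (set_stab \<Gamma> U))) AutT"
    by (rule AutT.subgroups_Inter) (use subgroup_set_stab[OF assms] in auto)
  then show ?thesis by (simp add: kernel_group_def)
qed

text \<open>With respect to a fixed set \<open>S\<close> of elements, the elements of a subgroup \<open>H\<close> all of whose
  commutators with \<open>S\<close> lie in \<open>H\<close> form a subgroup, as do those which commute with \<open>S\<close>.\<close>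

lemma (in group) subgroup_commutator_in:
  assumes H: "subgroup H G" and L: "subgroup L G" "L \<subseteq> H" "L = H \<or> L = {\<one>}" and S: "S \<subseteq> carrier G"
  shows "subgroup {h \<in> H. \<forall>g\<in>S. commutator G h g \<in> L} G"
proof -
  interpret H: subgroup H G by fact
  interpret L: subgroup L G by fact
  have alt: "commutator G h g \<in> L \<longleftrightarrow> g \<otimes> h \<otimes> inv g \<in> (if L = H then H else {h})"
    if h: "h \<in> H" and g: "g \<in> S" for h g
  proof -
    have c: "h \<in> carrier G" "g \<in> carrier G" using h g S by auto
    have eq: "commutator G h g = h \<otimes> inv (g \<otimes> h \<otimes> inv g)"
      using c by (simp add: commutator_def inv_mult_group m_assoc)
    have cc: "g \<otimes> h \<otimes> inv g \<in> carrier G" using c by simp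
    show ?thesis
    proof (cases "L = H")
      case True
      have "g \<otimes> h \<otimes> inv g \<in> H" if "h \<otimes> inv (g \<otimes> h \<otimes> inv g) \<in> H"
      proof -
        have "inv (h \<otimes> inv (g \<otimes> h \<otimes> inv g)) \<otimes> h \<in> H" using that h by simp
        moreover have "inv (h \<otimes> inv (g \<otimes> h \<otimes> inv g)) \<otimes> h = g \<otimes> h \<otimes> inv g"
          using c cc by (simp add: inv_mult_group m_assoc)
        ultimately show ?thesis by simp
      qed
      moreover have "h \<otimes> inv (g \<otimes> h \<otimes> inv g) \<in> H" if "g \<otimes> h \<otimes> inv g \<in> H"
        using h that by blast
      ultimately show ?thesis using True eq by auto
    next
      case False
      then have "L = {\<one>}" using L by simp
      moreover have "h \<otimes> inv (g \<otimes> h \<otimes> inv g) = \<one> \<longleftrightarrow> g \<otimes> h \<otimes> inv g = h"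
      proof
        assume "h \<otimes> inv (g \<otimes> h \<otimes> inv g) = \<one>"
        then have "inv (inv (g \<otimes> h \<otimes> inv g)) = h"
          by (rule inv_equality) (use c cc in auto)
        then show "g \<otimes> h \<otimes> inv g = h" using inv_inv[OF cc] by simp
      qed (use c in simp)
      ultimately show ?thesis using False eq by simp
    qed
  qed
  have set_eq: "{h \<in> H. \<forall>g\<in>S. commutator G h g \<in> L}
      = {h \<in> H. \<forall>g\<in>S. g \<otimes> h \<otimes> inv g \<in> (if L = H then H else {h})}"
    using alt by blast
  show ?thesis
    unfolding set_eq
  proof (rule subgroupI)
    show "{h \<in> H. \<forall>g\<in>S. g \<otimes> h \<otimes> inv g \<in> (if L = H then H else {h})} \<subseteq> carrier G" by auto
    show "{h \<in> H. \<forall>g\<in>S. g \<otimes> h \<otimes> inv g \<in> (if L = H then H else {h})} \<noteq> {}"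
      using S H.one_closed by (auto intro!: exI[of _ \<one>] simp: subsetD)
  next
    fix a assume a: "a \<in> {h \<in> H. \<forall>g\<in>S. g \<otimes> h \<otimes> inv g \<in> (if L = H then H else {h})}"
    have "g \<otimes> inv a \<otimes> inv g = inv (g \<otimes> a \<otimes> inv g)" if "g \<in> S" for g
      using a S that by (auto simp: inv_mult_group m_assoc subsetD)
    then show "inv a \<in> {h \<in> H. \<forall>g\<in>S. g \<otimes> h \<otimes> inv g \<in> (if L = H then H else {h})}"
      using a by (auto split: if_splits)
  next
    fix a b assume a: "a \<in> {h \<in> H. \<forall>g\<in>S. g \<otimes> h \<otimes> inv g \<in> (if L = H then H else {h})}"
      and b: "b \<in> {h \<in> H. \<forall>g\<in>S. g \<otimes> h \<otimes> inv g \<in> (if L = H then H else {h})}"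
    have "g \<otimes> (a \<otimes> b) \<otimes> inv g = (g \<otimes> a \<otimes> inv g) \<otimes> (g \<otimes> b \<otimes> inv g)" if "g \<in> S" for g
    proof -
      have c: "a \<in> carrier G" "b \<in> carrier G" "g \<in> carrier G" using a b S that by auto
      have "inv g \<otimes> (g \<otimes> (b \<otimes> inv g)) = b \<otimes> inv g"
        using c by (metis inv_closed l_inv l_one m_assoc m_closed)
      then show ?thesis using c by (simp add: m_assoc)
    qed
    then show "a \<otimes> b \<in> {h \<in> H. \<forall>g\<in>S. g \<otimes> h \<otimes> inv g \<in> (if L = H then H else {h})}"
      using a b by (auto split: if_splits)
  qed
qed

lemma subgroup_K_group:
  assumes "subgroup \<Gamma> AutT"
  shows "subgroup (K_group \<Gamma> U l) AutT"
  unfolding K_group_def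
  by (rule AutT.subgroup_commutator_in)
     (use subgroup_kernel_group[OF assms] subgroup.subset[OF subgroup_set_stab[OF assms]] in auto)

lemma subgroup_Z_group:
  assumes "subgroup \<Gamma> AutT"
  shows "subgroup (Z_group \<Gamma> U l) AutT"
proof -
  have "Z_group \<Gamma> U l
      = {h \<in> kernel_group \<Gamma> U. \<forall>g\<in>set_stab \<Gamma> U l. commutator AutT h g \<in> {\<one>\<^bsub>AutT\<^esub>}}"
    by (simp add: Z_group_def)
  also have "subgroup \<dots> AutT"
    by (rule AutT.subgroup_commutator_in)
       (use subgroup_kernel_group[OF assms] subgroup.subset[OF subgroup_set_stab[OF assms]]
          subgroup.one_closed[OF subgroup_kernel_group[OF assms]] AutT.triv_subgroup in auto)
  finally show ?thesis .
qed

lemma Z_group_subset_K_group: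
  assumes "subgroup \<Gamma> AutT"
  shows "Z_group \<Gamma> U l \<subseteq> K_group \<Gamma> U l"
  using subgroup.one_closed[OF subgroup_kernel_group[OF assms]]
  by (auto simp: Z_group_def K_group_def)

lemma set_stab_antimono:
  assumes "adapted_nbhd_basis \<Gamma> x U" "l \<le> m"
  shows "set_stab \<Gamma> U m \<subseteq> set_stab \<Gamma> U l"
proof -
  have "U (Suc n) \<subseteq> U n" for n
    using assms(1) unfolding adapted_nbhd_basis_def by (meson psubset_imp_subset)
  then have sub: "U m \<subseteq> U l"
    using assms(2) by (rule lift_Suc_antimono_le[of U])
  have ad: "adapted \<Gamma> (U l)" and "adapted \<Gamma> (U m)"
    using assms(1) by (simp_all add: adapted_nbhd_basis_def)
  then obtain y where y: "y \<in> U m" by (auto simp: adapted_def)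
  show ?thesis
  proof
    fix g assume g: "g \<in> set_stab \<Gamma> U m"
    then have "bdry_act g y \<in> U m" using y by (auto simp: set_stab_def)
    then have "bdry_act g ` U l \<inter> U l \<noteq> {}" using y sub by blast
    moreover have "g \<in> \<Gamma>" using g by (simp add: set_stab_def)
    ultimately show "g \<in> set_stab \<Gamma> U l"
      using ad unfolding adapted_def set_stab_def by blast
  qed
qed

lemma K_group_mono:
  assumes "subgroup \<Gamma> AutT" "adapted_nbhd_basis \<Gamma> x U" "l \<le> m"
  shows "K_group \<Gamma> U l \<subseteq> K_group \<Gamma> U m"
  using set_stab_antimono[OF assms(2,3)] by (auto simp: K_group_def)

lemma Z_group_mono:
  assumes "subgroup \<Gamma> AutT" "adapted_nbhd_basis \<Gamma> x U" "l \<le> m"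
  shows "Z_group \<Gamma> U l \<subseteq> Z_group \<Gamma> U m"
  using set_stab_antimono[OF assms(2,3)] by (auto simp: Z_group_def)

text \<open>For an increasing sequence \<open>S\<close> of subgroups of a group, the class of \<open>a\<close> in the direct limit
  along the inclusions is \<open>incl_class S a\<close>.\<close>

definition incl_class :: "(nat \<Rightarrow> 'a set) \<Rightarrow> 'a \<Rightarrow> (nat \<times> 'a) set" where
  "incl_class S a = {(j, a) | j. a \<in> S j}"

lemma dirlim_rel_incl:
  "dirlim_rel (\<lambda>l. G\<lparr>carrier := S l\<rparr>) (\<lambda>i j. id) `` {(i, a)} = (if a \<in> S i then incl_class S a else {})"
  by (auto simp: dirlim_rel_def incl_class_def intro: max.cobounded1 max.cobounded2)

lemma carrier_dirlim_incl:
  "carrier (dirlim (\<lambda>l. G\<lparr>carrier := S l\<rparr>) (\<lambda>i j. id)) = incl_class S ` (\<Union>i. S i)"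
proof -
  have "carrier (dirlim (\<lambda>l. G\<lparr>carrier := S l\<rparr>) (\<lambda>i j. id))
      = (\<Union>(i, a)\<in>(SIGMA i:UNIV. S i). {incl_class S a})"
    unfolding dirlim_def quotient_def partial_object.select_convs
  proof (rule SUP_cong)
    fix p assume "p \<in> (SIGMA i:UNIV. S i)"
    then obtain i a where "p = (i, a)" "a \<in> S i" by blast
    then show "{dirlim_rel (\<lambda>l. G\<lparr>carrier := S l\<rparr>) (\<lambda>i j. id) `` {p}}
        = (case p of (i, a) \<Rightarrow> {incl_class S a})"
      by (simp add: dirlim_rel_incl)
  qed simp
  also have "\<dots> = incl_class S ` (\<Union>i. S i)" by fast
  finally show ?thesis .
qed

lemma (in group) mult_dirlim_incl:
  assumes S: "\<And>i. subgroup (S i) G" "mono S" and ab: "a \<in> S i" "b \<in> S j"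
  shows "incl_class S a \<otimes>\<^bsub>dirlim (\<lambda>l. G\<lparr>carrier := S l\<rparr>) (\<lambda>i j. id)\<^esub> incl_class S b
           = incl_class S (a \<otimes> b)"
proof -
  have "{dirlim_rel (\<lambda>l. G\<lparr>carrier := S l\<rparr>) (\<lambda>i j. id) `` {(k, c \<otimes> d)} | i c j d k.
          (i, c) \<in> incl_class S a \<and> (j, d) \<in> incl_class S b \<and> i \<le> k \<and> j \<le> k}
        = {incl_class S (a \<otimes> b)}" (is "?L = _")
  proof (intro equalityI subsetI)
    fix X assume "X \<in> ?L"
    then obtain i j k where X: "X = dirlim_rel (\<lambda>l. G\<lparr>carrier := S l\<rparr>) (\<lambda>i j. id) `` {(k, a \<otimes> b)}"
      and "a \<in> S i" "b \<in> S j" "i \<le> k" "j \<le> k"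
      by (auto simp: incl_class_def)
    then have "a \<in> S k" "b \<in> S k"
      using monoD[OF S(2), of _ k] by blast+
    then have "a \<otimes> b \<in> S k" by (rule subgroup.m_closed[OF S(1)])
    then show "X \<in> {incl_class S (a \<otimes> b)}" by (simp add: X dirlim_rel_incl)
  next
    fix X assume X: "X \<in> {incl_class S (a \<otimes> b)}"
    have "a \<in> S (max i j)" "b \<in> S (max i j)"
      using ab monoD[OF S(2), of i "max i j"] monoD[OF S(2), of j "max i j"] by auto
    then have "a \<otimes> b \<in> S (max i j)" by (rule subgroup.m_closed[OF S(1)])
    then have "X = dirlim_rel (\<lambda>l. G\<lparr>carrier := S l\<rparr>) (\<lambda>i j. id) `` {(max i j, a \<otimes> b)}"
      using X by (simp add: dirlim_rel_incl)
    moreover have "(i, a) \<in> incl_class S a" "(j, b) \<in> incl_class S b"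
      using ab by (auto simp: incl_class_def)
    ultimately show "X \<in> ?L"
      using max.cobounded1[of i j] max.cobounded2[of j i] by blast
  qed
  then show ?thesis by (simp add: dirlim_def)
qed

lemma dirlim_map_incl:
  assumes "\<And>i. S i \<subseteq> S' i" "a \<in> S i"
  shows "dirlim_map (\<lambda>l. G\<lparr>carrier := S' l\<rparr>) (\<lambda>i j. id) (\<lambda>i. id) (incl_class S a) = incl_class S' a"
proof -
  have "dirlim_map (\<lambda>l. G\<lparr>carrier := S' l\<rparr>) (\<lambda>i j. id) (\<lambda>i. id) (incl_class S a)
      = (\<Union>p\<in>incl_class S a. incl_class S' a)"
    unfolding dirlim_map_def
  proof (rule SUP_cong)
    fix p assume "p \<in> incl_class S a"
    then obtain j where "p = (j, a)" "a \<in> S' j"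
      using assms(1) unfolding incl_class_def by blast
    then show "(case p of (i, a) \<Rightarrow> dirlim_rel (\<lambda>l. G\<lparr>carrier := S' l\<rparr>) (\<lambda>i j. id) `` {(i, id a)})
        = incl_class S' a"
      by (simp add: dirlim_rel_incl)
  qed simp
  also have "\<dots> = incl_class S' a"
    using assms(2) by (auto simp: incl_class_def)
  finally show ?thesis .
qed

lemma incl_class_inject:
  assumes "a \<in> S i" "incl_class S a = incl_class S b"
  shows "a = b"
proof -
  have "(i, a) \<in> incl_class S b"
    unfolding assms(2)[symmetric] using assms(1) by (auto simp: incl_class_def)
  then show ?thesis by (auto simp: incl_class_def)
qed

text \<open>The inclusion of direct limits is always an injective homomorphism, so it can only fail to be
  an isomorphism by failing to be surjective.\<close>

lemma Upsilon_incl_mon: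
  assumes \<Gamma>: "subgroup \<Gamma> AutT" and U: "adapted_nbhd_basis \<Gamma> x U"
  shows "Upsilon_incl \<Gamma> U \<in> mon (Upsilon_c \<Gamma> U) (Upsilon_s \<Gamma> U)"
proof -
  note ZK = Z_group_subset_K_group[OF \<Gamma>, of U]
  note sub = subgroup_Z_group[OF \<Gamma>, of U] subgroup_K_group[OF \<Gamma>, of U]
  have mono: "mono (Z_group \<Gamma> U)" "mono (K_group \<Gamma> U)"
    using Z_group_mono[OF \<Gamma> U] K_group_mono[OF \<Gamma> U] by (simp_all add: monoI)
  have carrier_c: "carrier (Upsilon_c \<Gamma> U) = incl_class (Z_group \<Gamma> U) ` (\<Union>l. Z_group \<Gamma> U l)"
    and carrier_s: "carrier (Upsilon_s \<Gamma> U) = incl_class (K_group \<Gamma> U) ` (\<Union>l. K_group \<Gamma> U l)"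
    by (simp_all only: Upsilon_c_def Upsilon_s_def carrier_dirlim_incl)
  have incl: "Upsilon_incl \<Gamma> U (incl_class (Z_group \<Gamma> U) a) = incl_class (K_group \<Gamma> U) a"
    if "a \<in> Z_group \<Gamma> U i" for a i
    unfolding Upsilon_incl_def by (rule dirlim_map_incl[where i = i]) (use ZK that in auto)
  have "Upsilon_incl \<Gamma> U \<in> hom (Upsilon_c \<Gamma> U) (Upsilon_s \<Gamma> U)"
  proof (rule homI)
    fix X assume "X \<in> carrier (Upsilon_c \<Gamma> U)"
    then obtain a i where a: "a \<in> Z_group \<Gamma> U i" "X = incl_class (Z_group \<Gamma> U) a"
      by (auto simp: carrier_c)
    then show "Upsilon_incl \<Gamma> U X \<in> carrier (Upsilon_s \<Gamma> U)"
      using incl[OF a(1)] subsetD[OF ZK a(1)] unfolding carrier_s by auto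
  next
    fix X Y assume "X \<in> carrier (Upsilon_c \<Gamma> U)" "Y \<in> carrier (Upsilon_c \<Gamma> U)"
    then obtain a i b j where a: "a \<in> Z_group \<Gamma> U i" "X = incl_class (Z_group \<Gamma> U) a"
      and b: "b \<in> Z_group \<Gamma> U j" "Y = incl_class (Z_group \<Gamma> U) b"
      by (auto simp: carrier_c)
    have "a \<in> Z_group \<Gamma> U (max i j)" "b \<in> Z_group \<Gamma> U (max i j)"
      using a b monoD[OF mono(1), of i "max i j"] monoD[OF mono(1), of j "max i j"] by auto
    then have ab: "a \<otimes>\<^bsub>AutT\<^esub> b \<in> Z_group \<Gamma> U (max i j)"
      by (rule subgroup.m_closed[OF sub(1)])
    have "X \<otimes>\<^bsub>Upsilon_c \<Gamma> U\<^esub> Y = incl_class (Z_group \<Gamma> U) (a \<otimes>\<^bsub>AutT\<^esub> b)"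
      unfolding a(2) b(2) Upsilon_c_def
      by (rule AutT.mult_dirlim_incl[OF sub(1) mono(1) a(1) b(1)])
    moreover have "incl_class (K_group \<Gamma> U) a \<otimes>\<^bsub>Upsilon_s \<Gamma> U\<^esub> incl_class (K_group \<Gamma> U) b
        = incl_class (K_group \<Gamma> U) (a \<otimes>\<^bsub>AutT\<^esub> b)"
      unfolding Upsilon_s_def
      by (rule AutT.mult_dirlim_incl[OF sub(2) mono(2) subsetD[OF ZK a(1)] subsetD[OF ZK b(1)]])
    ultimately show "Upsilon_incl \<Gamma> U (X \<otimes>\<^bsub>Upsilon_c \<Gamma> U\<^esub> Y)
        = Upsilon_incl \<Gamma> U X \<otimes>\<^bsub>Upsilon_s \<Gamma> U\<^esub> Upsilon_incl \<Gamma> U Y"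
      using incl[OF ab] incl[OF a(1)] incl[OF b(1)] a(2) b(2) by simp
  qed
  moreover have "inj_on (Upsilon_incl \<Gamma> U) (carrier (Upsilon_c \<Gamma> U))"
  proof (rule inj_onI)
    fix X Y assume "X \<in> carrier (Upsilon_c \<Gamma> U)" "Y \<in> carrier (Upsilon_c \<Gamma> U)"
      and eq: "Upsilon_incl \<Gamma> U X = Upsilon_incl \<Gamma> U Y"
    then obtain a i b j where a: "a \<in> Z_group \<Gamma> U i" "X = incl_class (Z_group \<Gamma> U) a"
      and b: "b \<in> Z_group \<Gamma> U j" "Y = incl_class (Z_group \<Gamma> U) b"
      by (auto simp: carrier_c)
    have "incl_class (K_group \<Gamma> U) a = incl_class (K_group \<Gamma> U) b"
      using eq incl[OF a(1)] incl[OF b(1)] a(2) b(2) by simp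
    then have "a = b" using subsetD[OF ZK a(1)] by (intro incl_class_inject[of a "K_group \<Gamma> U" i b])
    then show "X = Y" using a(2) b(2) by simp
  qed
  ultimately show ?thesis by (simp add: mon_def)
qed

end

theory Submission
  imports Defs
begin

text \<open>The group of \<^emph>\<open>finitary\<close> automorphisms has all the required properties. These are the
  automorphisms whose sections at all sufficiently deep vertices are trivial, that is, which change
  only letters up to a bounded depth. The group is self-similar and is contracting with nucleus
  \<open>{id}\<close>. It contains for every vertex \<open>w\<close> the automorphism \<open>flip w\<close> that changes the letter
  following the prefix \<open>w\<close>; by correcting one letter after the other with these, any infinite word
  can be moved as close as desired to any other one, so the action is minimal.

  On a small enough cylinder an element \<open>g\<close> only replaces the prefix \<open>w\<close> by \<open>g w\<close>. Hence two
  elements either agree on a whole cylinder about a point \<open>y\<close> or differ at all of its points,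
  which separates distinct germs at \<open>y\<close> and makes the germinal groupoid Hausdorff.

  Finally let \<open>x\<close> be an infinite word with an adapted neighborhood basis \<open>U\<close>, and let \<open>w\<close> be
  the vertex of length one that is not a prefix of \<open>x\<close>. By compactness some \<open>U l\<close> consists of words
  that start like \<open>x\<close>, so \<open>h = flip w\<close> is the identity on \<open>U l\<close> and lies in \<open>K_group\<close>
  (\<open>fixes_imp_K_group\<close>). However \<open>g = flip (w0)\<close> fixes \<open>x\<close> as well, therefore it
  stabilizes \<open>U m\<close> for every \<open>m\<close>, and it does not commute with \<open>h\<close>. So \<open>h\<close> belongs to no
  \<open>Z_group\<close>, and its class in the direct limit of stabilizers is not in the image.\<close>

section \<open>Cylinder sets of infinite words\<close>

lemma length_word_prefix [simp]: "length (word_prefix x n) = n"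
  by (simp add: word_prefix_def)

lemma word_prefix_eq_iff: "word_prefix x n = word_prefix y n \<longleftrightarrow> (\<forall>i<n. x i = y i)"
  by (auto simp: word_prefix_def)

lemma take_word_prefix: "m \<le> n \<Longrightarrow> take m (word_prefix x n) = word_prefix x m"
  by (simp add: word_prefix_def take_map)

lemma nth_word_prefix: "i < n \<Longrightarrow> word_prefix x n ! i = x i"
  by (simp add: word_prefix_def)

lemma word_prefix_split: "\<exists>k. word_prefix x (n + m) = word_prefix x n @ k"
  by (metis append_take_drop_id le_add1 take_word_prefix)

lemma open_cylinder: "open {z. word_prefix z n = word_prefix y n}"
proof -
  have "open {z :: boundary. \<forall>i\<in>{..<n}. z (id i) \<in> {y i}}"
    by (rule product_topology_basis') (auto simp: open_discrete)
  then show ?thesis by (simp add: word_prefix_eq_iff Ball_def)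
qed

lemma open_contains_cylinder:
  assumes "open V" "y \<in> V"
  obtains n where "{z. word_prefix z n = word_prefix y n} \<subseteq> V"
proof -
  have "openin (product_topology (\<lambda>i::nat. euclidean :: bool topology) UNIV) V"
    using assms(1) by (simp add: euclidean_product_topology)
  then obtain X where X: "y \<in> (\<Pi>\<^sub>E i\<in>UNIV. X i)" "finite {i. X i \<noteq> UNIV}" "(\<Pi>\<^sub>E i\<in>UNIV. X i) \<subseteq> V"
    using product_topology_open_contains_basis[OF _ assms(2)] by force
  obtain n where n: "\<And>i. X i \<noteq> UNIV \<Longrightarrow> i < n"
    using finite_nat_set_iff_bounded[THEN iffD1, OF X(2)] by auto
  have "z \<in> V" if z: "word_prefix z n = word_prefix y n" for z
  proof -
    have "z i \<in> X i" for i
    proof (cases "X i = UNIV")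
      case False
      then show ?thesis using n[OF False] z X(1) by (auto simp: word_prefix_eq_iff PiE_iff)
    qed simp
    then show ?thesis using X(3) by (auto simp: PiE_iff)
  qed
  then show ?thesis using that by blast
qed

lemma compact_UNIV_boundary: "compact (UNIV :: boundary set)"
proof -
  have "compact_space (euclidean :: bool topology)"
    by (simp add: compact_space_def finite_imp_compact)
  then have "compact_space (product_topology (\<lambda>i::nat. euclidean :: bool topology) UNIV)"
    by (simp add: compact_space_product_topology)
  then show ?thesis by (simp add: euclidean_product_topology compact_space_def)
qed


section \<open>Automorphisms of the tree\<close>

lemma AutT_I:
  assumes bij: "bij g" and len: "\<And>u. length (g u) = length u"
    and snoc: "\<And>u b. \<exists>c. g (u @ [b]) = g u @ [c]"
  shows "g \<in> carrier AutT"
proof -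
  have child: "(\<exists>b. g v = g u @ [b]) \<longleftrightarrow> (\<exists>b. v = u @ [b])" for u v
  proof
    assume "\<exists>b. g v = g u @ [b]"
    then obtain b where b: "g v = g u @ [b]" ..
    then have "length v = Suc (length u)" by (metis len length_append_singleton)
    then obtain v' c where v: "v = v' @ [c]" by (metis length_Suc_conv_rev)
    then obtain d where "g v = g v' @ [d]" using snoc by blast
    then have "g v' = g u" using b by simp
    then show "\<exists>b. v = u @ [b]" using v bij by (auto dest!: bij_is_inj injD)
  qed (use snoc in auto)
  have "g [] = []" using len[of "[]"] by simp
  then show ?thesis using bij child by (simp add: AutT_carrier tree_edge_def)
qed

lemma tree_section_AutT:
  assumes g: "g \<in> carrier AutT"
  shows "tree_section g w \<in> carrier AutT"
proof (rule AutT_I)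
  note eq = section_eq[OF g, of w]
  have bij: "bij g" using g by (simp add: AutT_carrier)
  show "bij (tree_section g w)"
  proof (rule bijI)
    show "inj (tree_section g w)"
      by (rule injI) (metis eq bij bij_is_inj injD same_append_eq)
    have "\<exists>k. v = tree_section g w k" for v
    proof -
      obtain z where z: "g z = g w @ v" using bij by (metis bij_pointE)
      define z1 z2 where "z1 = take (length w) z" and "z2 = drop (length w) z"
      have zz: "z = z1 @ z2" by (simp add: z1_def z2_def)
      have "length z = length w + length v"
        using AutT_length[OF g] z by (metis length_append)
      then have "length (g z1) = length (g w)" by (simp add: AutT_length[OF g] z1_def)
      then have "g z1 = g w" using z section_eq[OF g, of z1 z2] by (simp add: zz)
      then have "z1 = w" using bij by (auto dest!: bij_is_inj injD)
      then show ?thesis using z eq zz by auto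
    qed
    then show "surj (tree_section g w)" unfolding surj_def by blast
  qed
  show "length (tree_section g w u) = length u" for u
    using AutT_length[OF g, of "w @ u"] AutT_length[OF g, of w] eq[of u] by simp
  show "\<exists>c. tree_section g w (u @ [b]) = tree_section g w u @ [c]" for u b
    using AutT_snoc[OF g, of "w @ u" b] eq[of u] eq[of "u @ [b]"] by auto
qed


section \<open>The group of finitary automorphisms\<close>

text \<open>An automorphism is finitary if from some depth on it leaves all letters unchanged. The
  condition at the vertex \<open>w\<close> says that the section at \<open>w\<close> is trivial.\<close>

definition finitary :: "(vertex \<Rightarrow> vertex) set" where
  "finitary = {g \<in> carrier AutT. \<exists>n. \<forall>w k. n \<le> length w \<longrightarrow> g (w @ k) = g w @ k}"

lemma finitary_AutT: "g \<in> finitary \<Longrightarrow> g \<in> carrier AutT"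
  by (simp add: finitary_def)

lemma subgroup_finitary: "subgroup finitary AutT"
proof (rule AutT.subgroupI)
  show "finitary \<subseteq> carrier AutT" by (auto simp: finitary_def)
  have "id \<in> finitary" using AutT.one_closed by (simp add: finitary_def)
  then show "finitary \<noteq> {}" by blast
next
  fix g assume "g \<in> finitary"
  then obtain n where g: "g \<in> carrier AutT"
    and n: "\<And>w k. n \<le> length w \<Longrightarrow> g (w @ k) = g w @ k"
    by (auto simp: finitary_def)
  let ?i = "inv\<^bsub>AutT\<^esub> g"
  have i: "?i \<in> carrier AutT" using g by simp
  have gi: "g (?i u) = u" and ig: "?i (g u) = u" for u
    using AutT.r_inv[OF g] AutT.l_inv[OF g] by (simp_all add: fun_eq_iff)
  have "?i (u @ k) = ?i u @ k" if "n \<le> length u" for u k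
    using n[of "?i u" k] that ig[of "?i u @ k"] by (simp add: gi AutT_length[OF i])
  then show "?i \<in> finitary" using i by (auto simp: finitary_def)
next
  fix g h assume gh: "g \<in> finitary" "h \<in> finitary"
  obtain n where g: "g \<in> carrier AutT" "\<And>w k. n \<le> length w \<Longrightarrow> g (w @ k) = g w @ k"
    using gh(1) by (auto simp: finitary_def)
  obtain m where h: "h \<in> carrier AutT" "\<And>w k. m \<le> length w \<Longrightarrow> h (w @ k) = h w @ k"
    using gh(2) by (auto simp: finitary_def)
  have "(g \<circ> h) (w @ k) = (g \<circ> h) w @ k" if "max n m \<le> length w" for w k
    using that by (simp add: g(2) h(2) AutT_length[OF h(1)])
  moreover have "g \<circ> h \<in> carrier AutT" using AutT.m_closed[OF g(1) h(1)] by simp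
  ultimately show "g \<otimes>\<^bsub>AutT\<^esub> h \<in> finitary" unfolding finitary_def AutT_simps by blast
qed

lemma self_similar_finitary: "self_similar finitary"
  unfolding self_similar_def
proof (intro conjI ballI allI)
  fix g w assume "g \<in> finitary"
  then obtain n where g: "g \<in> carrier AutT"
    and n: "\<And>w k. n \<le> length w \<Longrightarrow> g (w @ k) = g w @ k"
    by (auto simp: finitary_def)
  have "tree_section g w (u @ k) = tree_section g w u @ k" if "n \<le> length u" for u k
    using n[of "w @ u" k] that section_eq[OF g, of w "u @ k"] section_eq[OF g, of w u] by simp
  then show "tree_section g w \<in> finitary"
    using tree_section_AutT[OF g] by (auto simp: finitary_def)
qed (rule subgroup_finitary)

lemma contracting_finitary: "contracting finitary"
  unfolding contracting_def
proof (intro exI[of _ "{id}"] conjI ballI)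
  show "{id} \<subseteq> finitary" using subgroup.one_closed[OF subgroup_finitary] by simp
  fix g assume "g \<in> finitary"
  then obtain n where "\<And>w k. n \<le> length w \<Longrightarrow> g (w @ k) = g w @ k"
    by (auto simp: finitary_def)
  then show "\<exists>n. \<forall>w. n \<le> length w \<longrightarrow> tree_section g w \<in> {id}"
    by (intro exI[of _ n]) (simp add: tree_section_def fun_eq_iff)
qed simp


section \<open>Flipping one letter\<close>

text \<open>\<open>flip w\<close> changes the letter following the prefix \<open>w\<close>, that is, it exchanges the subtrees
  at the two children of \<open>w\<close>.\<close>

definition flip :: "vertex \<Rightarrow> vertex \<Rightarrow> vertex" where
  "flip w u = (if length w < length u \<and> take (length w) u = w
               then u[length w := \<not> u ! length w] else u)"

lemma flip_flip: "flip w (flip w u) = u"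
  by (auto simp: flip_def)

lemma flip_append: "length w < length u \<Longrightarrow> flip w (u @ k) = flip w u @ k"
  by (simp add: flip_def nth_append list_update_append)

lemma flip_AutT: "flip w \<in> carrier AutT"
proof (rule AutT_I)
  show "bij (flip w)" by (rule o_bij[of "flip w"]) (auto simp: flip_flip)
  show "length (flip w u) = length u" for u by (simp add: flip_def)
  show "\<exists>c. flip w (u @ [b]) = flip w u @ [c]" for u b
    by (cases "length w < length u")
       (auto simp: flip_append, auto simp: flip_def list_update_append)
qed

lemma flip_finitary: "flip w \<in> finitary"
  using flip_AutT flip_append Suc_le_eq unfolding finitary_def by blast

lemma bdry_act_flip:
  "bdry_act (flip w) z n = (if n = length w \<and> word_prefix z n = w then \<not> z n else z n)"
  by (auto simp: bdry_act_def flip_def nth_word_prefix take_word_prefix nth_list_update)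

lemma minimal_action_finitary: "minimal_action finitary"
  unfolding minimal_action_def
proof (intro allI)
  fix x
  have approx: "\<exists>g\<in>finitary. word_prefix (bdry_act g x) n = word_prefix y n" for y n
  proof (induction n)
    case 0
    show ?case using flip_finitary[of "[]"] by (auto simp: word_prefix_def)
  next
    case (Suc n)
    then obtain g where g: "g \<in> finitary" "word_prefix (bdry_act g x) n = word_prefix y n"
      by blast
    show ?case
    proof (cases "bdry_act g x n = y n")
      case True
      then show ?thesis using g by (auto simp: word_prefix_eq_iff less_Suc_eq)
    next
      case False
      define f where "f = flip (word_prefix y n)"
      have "word_prefix (bdry_act f (bdry_act g x)) (Suc n) = word_prefix y (Suc n)"
        using g(2) False by (auto simp: word_prefix_eq_iff less_Suc_eq f_def bdry_act_flip)
      moreover have "bdry_act (f \<circ> g) x = bdry_act f (bdry_act g x)"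
        using g(1) flip_AutT by (simp add: bdry_act_comp finitary_AutT f_def)
      moreover have "f \<circ> g \<in> finitary"
        using subgroup.m_closed[OF subgroup_finitary, of f g] g(1) flip_finitary
        by (simp add: f_def)
      ultimately show ?thesis by metis
    qed
  qed
  show "closure ((\<lambda>g. bdry_act g x) ` finitary) = UNIV"
  proof (rule ccontr)
    assume "closure ((\<lambda>g. bdry_act g x) ` finitary) \<noteq> UNIV"
    then obtain y where "y \<in> - closure ((\<lambda>g. bdry_act g x) ` finitary)" by blast
    then obtain n where n: "{z. word_prefix z n = word_prefix y n}
        \<subseteq> - closure ((\<lambda>g. bdry_act g x) ` finitary)"
      using open_contains_cylinder[OF open_Compl[OF closed_closure]] by metis
    obtain g where g: "g \<in> finitary" "word_prefix (bdry_act g x) n = word_prefix y n"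
      using approx by blast
    then have "bdry_act g x \<in> closure ((\<lambda>g. bdry_act g x) ` finitary)"
      by (intro subsetD[OF closure_subset] imageI)
    then show False using n g(2) by blast
  qed
qed


section \<open>Separation of germs\<close>

text \<open>On a cylinder below the depth of two finitary automorphisms, the action of each is determined
  by the image of the prefix, so they agree either everywhere or nowhere.\<close>

lemma finitary_agree_or_differ:
  assumes "g \<in> finitary" "h \<in> finitary"
  obtains n where
    "(\<forall>z. word_prefix z n = word_prefix y n \<longrightarrow> bdry_act g z = bdry_act h z) \<or>
     (\<forall>z. word_prefix z n = word_prefix y n \<longrightarrow> bdry_act g z \<noteq> bdry_act h z)"
proof -
  obtain n1 where g: "g \<in> carrier AutT" "\<And>w k. n1 \<le> length w \<Longrightarrow> g (w @ k) = g w @ k"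
    using assms(1) by (auto simp: finitary_def)
  obtain n2 where h: "h \<in> carrier AutT" "\<And>w k. n2 \<le> length w \<Longrightarrow> h (w @ k) = h w @ k"
    using assms(2) by (auto simp: finitary_def)
  define n where "n = max n1 n2"
  let ?w = "word_prefix y n"
  show ?thesis
  proof (cases "g ?w = h ?w")
    case True
    have "bdry_act g z = bdry_act h z" if z: "word_prefix z n = ?w" for z
    proof
      fix i
      obtain k where "word_prefix z (n + Suc i) = ?w @ k"
        using word_prefix_split[of z n "Suc i"] z by auto
      then have "word_prefix (bdry_act g z) (n + Suc i) = word_prefix (bdry_act h z) (n + Suc i)"
        using True by (simp only: word_prefix_bdry_act[OF g(1)] word_prefix_bdry_act[OF h(1)])
          (simp add: g(2) h(2) n_def)
      then show "bdry_act g z i = bdry_act h z i" by (simp add: word_prefix_eq_iff)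
    qed
    then show ?thesis using that by blast
  next
    case False
    have "bdry_act g z \<noteq> bdry_act h z" if z: "word_prefix z n = ?w" for z
      using False z word_prefix_bdry_act[OF g(1), of z n] word_prefix_bdry_act[OF h(1), of z n]
      by auto
    then show ?thesis using that by blast
  qed
qed

lemma openin_germ_image:
  "g \<in> \<Gamma> \<Longrightarrow> open V \<Longrightarrow> openin (germinal_groupoid \<Gamma>) (germ \<Gamma> g ` V)"
  unfolding germinal_groupoid_def
  by (rule topology_generated_by_Basis) (auto simp: germ_base_def)

lemma germ_eq_iff:
  assumes "g \<in> \<Gamma>" "h \<in> \<Gamma>"
  shows "germ \<Gamma> g y = germ \<Gamma> h z \<longleftrightarrow> y = z \<and> (g, h) \<in> germ_rel \<Gamma> y"
  using eq_equiv_class_iff[OF equiv_germ_rel assms] by (auto simp: germ_def)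

lemma Hausdorff_germinal_groupoid_finitary: "Hausdorff_space (germinal_groupoid finitary)"
  unfolding Hausdorff_space_def
proof (intro allI impI)
  fix p q
  assume pq: "p \<in> topspace (germinal_groupoid finitary)
    \<and> q \<in> topspace (germinal_groupoid finitary) \<and> p \<noteq> q"
  then obtain g y h z where g: "g \<in> finitary" and p: "p = germ finitary g y"
    and h: "h \<in> finitary" and q: "q = germ finitary h z"
    by (auto simp: topspace_germinal_groupoid)
  let ?separated = "\<exists>V W. openin (germinal_groupoid finitary) V \<and>
      openin (germinal_groupoid finitary) W \<and> p \<in> V \<and> q \<in> W \<and> disjnt V W"
  have sep: ?separated
    if VW: "open V" "open W" "y \<in> V" "z \<in> W"
      and differ: "\<And>v. v \<in> V \<Longrightarrow> v \<in> W \<Longrightarrow> bdry_act g v \<noteq> bdry_act h v" for V W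
  proof -
    have "germ finitary g v \<noteq> germ finitary h u" if "v \<in> V" "u \<in> W" for u v
      using that differ by (auto simp: germ_eq_iff[OF g h] germ_rel_def)
    then have "disjnt (germ finitary g ` V) (germ finitary h ` W)"
      by (force simp: disjnt_iff)
    then show ?thesis
      using VW openin_germ_image[OF g, of V] openin_germ_image[OF h, of W] unfolding p q by blast
  qed
  show ?separated
  proof (cases "y = z")
    case False
    then obtain i where i: "y i \<noteq> z i" by auto
    show ?thesis
      by (rule sep[OF open_cylinder[of "Suc i" y] open_cylinder[of "Suc i" z]])
        (use i in \<open>auto simp: word_prefix_eq_iff\<close>)
  next
    case True
    obtain n where n:
      "(\<forall>z. word_prefix z n = word_prefix y n \<longrightarrow> bdry_act g z = bdry_act h z) \<or>
       (\<forall>z. word_prefix z n = word_prefix y n \<longrightarrow> bdry_act g z \<noteq> bdry_act h z)"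
      using finitary_agree_or_differ[OF g h] by blast
    let ?V = "{z. word_prefix z n = word_prefix y n}"
    \<comment> \<open>if the actions agreed on the cylinder, the germs at \<open>y\<close> would be equal\<close>
    have "(g, h) \<notin> germ_rel finitary y"
      using pq True by (simp add: p q germ_eq_iff[OF g h])
    then have "\<not> (\<forall>z\<in>?V. bdry_act g z = bdry_act h z)"
      using g h open_cylinder[of n y] unfolding germ_rel_def by blast
    then have "\<And>v. v \<in> ?V \<Longrightarrow> bdry_act g v \<noteq> bdry_act h v"
      using n by blast
    then show ?thesis
      using True by (intro sep[OF open_cylinder open_cylinder]) auto
  qed
qed


section \<open>Stabilizers and centralizers\<close>

text \<open>An element that fixes the base point maps every \<open>U l\<close> to a set that meets \<open>U l\<close>, hence to
  \<open>U l\<close> itself, because \<open>U l\<close> is adapted.\<close>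

lemma fixes_imp_kernel_group:
  assumes U: "adapted_nbhd_basis \<Gamma> x U" and g: "g \<in> \<Gamma>" "bdry_act g x = x"
  shows "g \<in> kernel_group \<Gamma> U"
proof -
  have "bdry_act g ` U l = U l" for l
  proof -
    have x: "x \<in> U l" and "adapted \<Gamma> (U l)" using U by (simp_all add: adapted_nbhd_basis_def)
    then have "bdry_act g ` U l = U l \<or> bdry_act g ` U l \<inter> U l = {}"
      using g(1) by (simp add: adapted_def)
    moreover have "x \<in> bdry_act g ` U l" using x g(2) by (metis image_eqI)
    ultimately show ?thesis using x by blast
  qed
  then show ?thesis using g(1) by (simp add: kernel_group_def set_stab_def)
qed

lemma bdry_act_inv:
  assumes "g \<in> carrier AutT"
  shows "bdry_act (inv\<^bsub>AutT\<^esub> g) (bdry_act g x) = x" "bdry_act g (bdry_act (inv\<^bsub>AutT\<^esub> g) x) = x"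
  using bdry_act_comp[of "inv\<^bsub>AutT\<^esub> g" g x] bdry_act_comp[of g "inv\<^bsub>AutT\<^esub> g" x]
    AutT.l_inv[OF assms] AutT.r_inv[OF assms] assms by simp_all

text \<open>If \<open>h\<close> is the identity on \<open>U l\<close> and \<open>g\<close> stabilizes \<open>U l\<close>, then the commutator of \<open>h\<close> and
  \<open>g\<close> fixes \<open>x\<close>, since \<open>h\<close> fixes both \<open>x\<close> and its image under the inverse of \<open>g\<close>.\<close>

lemma fixes_imp_K_group:
  assumes \<Gamma>: "subgroup \<Gamma> AutT" and U: "adapted_nbhd_basis \<Gamma> x U"
    and h: "h \<in> \<Gamma>" "\<And>z. z \<in> U l \<Longrightarrow> bdry_act h z = z"
  shows "h \<in> K_group \<Gamma> U l"
proof -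
  interpret \<Gamma>: subgroup \<Gamma> AutT by fact
  have x: "x \<in> U l" using U by (simp add: adapted_nbhd_basis_def)
  have "commutator AutT h g \<in> kernel_group \<Gamma> U" if g: "g \<in> set_stab \<Gamma> U l" for g
  proof (rule fixes_imp_kernel_group[OF U])
    have g\<Gamma>: "g \<in> \<Gamma>" using g by (simp add: set_stab_def)
    then show "commutator AutT h g \<in> \<Gamma>"
      using h(1) unfolding commutator_def by (intro \<Gamma>.m_closed) auto
    let ?y = "bdry_act (inv\<^bsub>AutT\<^esub> g) x"
    have c: "g \<in> carrier AutT" "h \<in> carrier AutT" using g\<Gamma> h(1) by auto
    note ic = AutT.inv_closed[OF c(1)] AutT.inv_closed[OF c(2)]
    have "inv\<^bsub>AutT\<^esub> g \<in> set_stab \<Gamma> U l"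
      using subgroup.m_inv_closed[OF subgroup_set_stab[OF \<Gamma>] g] .
    then have "?y \<in> U l" using x by (auto simp: set_stab_def)
    then have "bdry_act (inv\<^bsub>AutT\<^esub> h) ?y = ?y"
      using bdry_act_inv(1)[OF c(2), of ?y] h(2) by simp
    moreover have "bdry_act (commutator AutT h g) x
        = bdry_act h (bdry_act g (bdry_act (inv\<^bsub>AutT\<^esub> h) ?y))"
      using c ic AutT.m_closed[OF c(2) c(1)] AutT.m_closed[OF AutT.m_closed[OF c(2) c(1)] ic(2)]
      by (simp add: commutator_def bdry_act_comp)
    ultimately show "bdry_act (commutator AutT h g) x = x"
      using bdry_act_inv(2)[OF c(1), of x] h(2)[OF x] by simp
  qed
  moreover have "h \<in> kernel_group \<Gamma> U"
    using fixes_imp_kernel_group[OF U h(1)] h(2) x by simp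
  ultimately show ?thesis by (simp add: K_group_def)
qed

lemma Z_group_commutes:
  assumes "subgroup \<Gamma> AutT" "h \<in> Z_group \<Gamma> U l" "g \<in> set_stab \<Gamma> U l"
  shows "h \<circ> g = g \<circ> h"
proof -
  have "h \<in> kernel_group \<Gamma> U" using assms(2) by (simp add: Z_group_def)
  then have c: "h \<in> carrier AutT" "g \<in> carrier AutT"
    using subsetD[OF subgroup.subset[OF subgroup_kernel_group[OF assms(1)]]]
      subsetD[OF subgroup.subset[OF subgroup_set_stab[OF assms(1)]] assms(3)] by blast+
  have "commutator AutT h g = \<one>\<^bsub>AutT\<^esub>" using assms(2,3) unfolding Z_group_def by blast
  then have "h \<otimes>\<^bsub>AutT\<^esub> g \<otimes>\<^bsub>AutT\<^esub> inv\<^bsub>AutT\<^esub> (g \<otimes>\<^bsub>AutT\<^esub> h) = \<one>\<^bsub>AutT\<^esub>"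
    using c by (simp del: AutT_simps add: commutator_def AutT.inv_mult_group AutT.m_assoc)
  then have "inv\<^bsub>AutT\<^esub> (inv\<^bsub>AutT\<^esub> (g \<otimes>\<^bsub>AutT\<^esub> h)) = h \<otimes>\<^bsub>AutT\<^esub> g"
    using c AutT.m_closed AutT.inv_closed by (intro AutT.inv_equality) blast+
  then show ?thesis using c AutT.m_closed[OF c(2,1)] AutT.inv_inv by simp
qed

text \<open>Both direct limits are increasing unions, so surjectivity of the map between them is an
  inclusion of unions.\<close>

lemma Upsilon_incl_iso_imp_subset:
  assumes \<Gamma>: "subgroup \<Gamma> AutT" and iso: "Upsilon_incl \<Gamma> U \<in> iso (Upsilon_c \<Gamma> U) (Upsilon_s \<Gamma> U)"
  shows "(\<Union>l. K_group \<Gamma> U l) \<subseteq> (\<Union>l. Z_group \<Gamma> U l)"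
proof
  fix h assume "h \<in> (\<Union>l. K_group \<Gamma> U l)"
  then obtain l where h: "h \<in> K_group \<Gamma> U l" by blast
  then have "incl_class (K_group \<Gamma> U) h \<in> carrier (Upsilon_s \<Gamma> U)"
    unfolding Upsilon_s_def carrier_dirlim_incl by blast
  then obtain X where X: "X \<in> carrier (Upsilon_c \<Gamma> U)"
    "Upsilon_incl \<Gamma> U X = incl_class (K_group \<Gamma> U) h"
    using iso by (auto simp: iso_def bij_betw_def) (metis imageE)
  then obtain a i where a: "a \<in> Z_group \<Gamma> U i" "X = incl_class (Z_group \<Gamma> U) a"
    unfolding Upsilon_c_def carrier_dirlim_incl by blast
  have "incl_class (K_group \<Gamma> U) h = incl_class (K_group \<Gamma> U) a"
    using X(2) dirlim_map_incl[of "Z_group \<Gamma> U" "K_group \<Gamma> U", OF Z_group_subset_K_group[OF \<Gamma>] a(1)]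
    unfolding Upsilon_incl_def a(2) by metis
  then have "h = a" by (rule incl_class_inject[where S = "K_group \<Gamma> U", OF h])
  then show "h \<in> (\<Union>l. Z_group \<Gamma> U l)" using a(1) by blast
qed

text \<open>The members of an adapted neighborhood basis become arbitrarily small, by compactness of
  the boundary.\<close>

lemma adapted_nbhd_basis_small:
  assumes U: "adapted_nbhd_basis \<Gamma> x U" and V: "open V" "x \<in> V"
  obtains l where "U l \<subseteq> V"
proof -
  have "\<exists>l. U l \<subseteq> V"
  proof (rule ccontr)
    assume none: "\<nexists>l. U l \<subseteq> V"
    have dec: "U n \<subseteq> U m" if "m \<le> n" for m n
      using lift_Suc_antimono_le[of U, OF _ that] U unfolding adapted_nbhd_basis_def
      by (meson psubset_imp_subset)
    have "compact (- V)"
      using compact_Int_closed[OF compact_UNIV_boundary, of "- V"] V(1) by (simp add: closed_def)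
    then have "- V \<inter> (\<Inter>l\<in>UNIV. U l) \<noteq> {}"
    proof (rule compact_imp_fip_image)
      show "closed (U l)" for l using U by (simp add: adapted_nbhd_basis_def adapted_def)
      fix I :: "nat set" assume "finite I"
      then obtain m where "\<And>i. i \<in> I \<Longrightarrow> i \<le> m"
        by (metis finite_nat_set_iff_bounded_le)
      then have "U m \<subseteq> (\<Inter>l\<in>I. U l)" using dec by blast
      then show "- V \<inter> (\<Inter>l\<in>I. U l) \<noteq> {}" using none by blast
    qed
    moreover have "(\<Inter>l. U l) = {x}" using U by (simp add: adapted_nbhd_basis_def)
    ultimately show False using V(2) by auto
  qed
  then show ?thesis using that by blast
qed

lemma Upsilon_incl_finitary_not_iso:
  assumes U: "adapted_nbhd_basis finitary x U"
  shows "Upsilon_incl finitary U \<notin> iso (Upsilon_c finitary U) (Upsilon_s finitary U)"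
proof
  assume iso: "Upsilon_incl finitary U \<in> iso (Upsilon_c finitary U) (Upsilon_s finitary U)"
  let ?b = "\<not> x 0"
  define h where "h = flip [?b]"
  define g where "g = flip [?b, False]"
  have pre: "word_prefix z (Suc 0) = [z 0]" for z by (simp add: word_prefix_def)
  obtain l where "U l \<subseteq> {z. word_prefix z (Suc 0) = word_prefix x (Suc 0)}"
    by (rule adapted_nbhd_basis_small[OF U open_cylinder]) auto
  then have "bdry_act h z = z" if "z \<in> U l" for z
    using that by (auto simp: h_def fun_eq_iff bdry_act_flip pre)
  then have "h \<in> K_group finitary U l"
    using fixes_imp_K_group[OF subgroup_finitary U] flip_finitary by (simp add: h_def)
  then obtain m where m: "h \<in> Z_group finitary U m"
    using Upsilon_incl_iso_imp_subset[OF subgroup_finitary iso] by blast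
  have "bdry_act g x = x"
    by (auto simp: g_def fun_eq_iff bdry_act_flip word_prefix_def)
  then have "g \<in> set_stab finitary U m"
    using fixes_imp_kernel_group[OF U, of g] flip_finitary by (simp add: g_def kernel_group_def)
  \<comment> \<open>\<open>h\<close> changes the letter after \<open>?b\<close>, and \<open>g\<close> acts only if this letter is \<open>False\<close>\<close>
  then have "(h \<circ> g) [?b, False, False] = (g \<circ> h) [?b, False, False]"
    using Z_group_commutes[OF subgroup_finitary m] by simp
  then show False by (simp add: g_def h_def flip_def)
qed

theorem theorem1p4:
  "\<exists>\<Gamma>. self_similar \<Gamma> \<and> contracting \<Gamma> \<and> minimal_action \<Gamma> \<and>
     (\<forall>x U. adapted_nbhd_basis \<Gamma> x U \<longrightarrow>
        Upsilon_incl \<Gamma> U \<notin> iso (Upsilon_c \<Gamma> U) (Upsilon_s \<Gamma> U)) \<and>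
     Hausdorff_space (germinal_groupoid \<Gamma>)"
  using self_similar_finitary contracting_finitary minimal_action_finitary
    Upsilon_incl_finitary_not_iso Hausdorff_germinal_groupoid_finitary by blast

end
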